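(* Any quantum algorithm that solves the Longest Lyndon Substring problem on strings of length $n$ (i.e. outputs the maximum $\ell$ such that $s[i..i+\ell)$ is a Lyndon word for some $i\in[1..n-\ell+1]$) requires $\Omega(\sqrt n)$ quantum queries.
   Context: Strings are 1-indexed sequences over a totally ordered (integer) alphabet; $s[i..j)=s[i]\cdots s[j-1]$. $\prec$ is the lexicographic order: $s\prec t$ if $s$ is a proper prefix of $t$, or at the first position where they differ $s$ has the smaller character. A nonempty string $w$ is a Lyndon word if $w\prec v$ for every nonempty proper suffix $v$ of $w$. Quantum query model: the input string $s$ is accessed through a unitary oracle $O_s:|i,b\rangle\mapsto|i,b\oplus s[i]\rangle$ ($\oplus$ is XOR of binary encodings of characters), which can be queried in superposition; between queries the algorithm may apply arbitrary unitaries independent of the input; it must output the correct answer with probability at least $2/3$. Query complexity is the number of oracle calls. *)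

theory Defs
  imports
    Complex_Main
    "HOL-Library.Sublist"
    "Jordan_Normal_Form.Schur_Decomposition"
begin

section \<open>Lyndon substrings\<close>

text \<open>
  Strings are lists over natural numbers; positions are 1-based as in the mathematical text,
  so \<open>s[i]\<close> is the list entry with index \<open>i - 1\<close>.
\<close>

definition char_at :: "nat list \<Rightarrow> nat \<Rightarrow> nat" where
  "char_at s i = s ! (i - 1)"

definition substring :: "nat list \<Rightarrow> nat \<Rightarrow> nat \<Rightarrow> nat list" where
  "substring s i j = take (j - i) (drop (i - 1) s)"

definition lex_less :: "nat list \<Rightarrow> nat list \<Rightarrow> bool" (infix "\<prec>\<^sub>l\<^sub>e\<^sub>x" 50) where
  "s \<prec>\<^sub>l\<^sub>e\<^sub>x t \<longleftrightarrow> (s, t) \<in> lexord {(a, b). a < b}"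

definition lyndon :: "nat list \<Rightarrow> bool" where
  "lyndon w \<longleftrightarrow> w \<noteq> [] \<and> (\<forall>v. v \<noteq> [] \<and> strict_suffix v w \<longrightarrow> w \<prec>\<^sub>l\<^sub>e\<^sub>x v)"

text \<open>
  The condition \<open>i + l \<le> length s + 1\<close> is \<open>i \<le> n - l + 1\<close> without truncated subtraction.
  For nonempty \<open>s\<close> the set is finite and contains 1.
\<close>

definition longest_lyndon :: "nat list \<Rightarrow> nat" where
  "longest_lyndon s =
     Max {l. \<exists>i. 1 \<le> i \<and> i + l \<le> length s + 1 \<and> lyndon (substring s i (i + l))}"

definition strings :: "nat set \<Rightarrow> nat \<Rightarrow> nat list set" where
  "strings \<Sigma> n = {s. length s = n \<and> set s \<subseteq> \<Sigma>}"

section \<open>Quantum query algorithms\<close>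

text \<open>
  For string length \<open>n\<close>, characters encoded in \<open>m\<close> bits and a workspace of dimension \<open>d\<close>, the
  computational basis states are \<open>|i,b,w\<rangle>\<close> with \<open>i \<in> {1..n}\<close>, \<open>b < 2 ^ m\<close> and \<open>w < d\<close>. They are
  numbered bijectively by \<open>ket_index\<close>, so that states are vectors of dimension \<open>state_dim n m d\<close>.
\<close>

definition state_dim :: "nat \<Rightarrow> nat \<Rightarrow> nat \<Rightarrow> nat" where
  "state_dim n m d = n * 2 ^ m * d"

definition ket_index :: "nat \<Rightarrow> nat \<Rightarrow> nat \<Rightarrow> nat \<Rightarrow> nat \<Rightarrow> nat" where
  "ket_index m d i b w = ((i - 1) * 2 ^ m + b) * d + w"

text \<open>
  The oracle sends \<open>|i,b,w\<rangle>\<close> to \<open>|i, b \<oplus> s[i], w\<rangle>\<close>; \<open>xor\<close> on natural numbers is bitwise exclusive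
  or of their binary encodings.
\<close>

definition oracle_mat :: "nat \<Rightarrow> nat \<Rightarrow> nat list \<Rightarrow> complex mat" where
  "oracle_mat m d s = mat (state_dim (length s) m d) (state_dim (length s) m d)
     (\<lambda>(r, c). if \<exists>i \<in> {1..length s}. \<exists>b < 2 ^ m. \<exists>w < d.
                    c = ket_index m d i b w \<and> r = ket_index m d i (xor b (char_at s i)) w
               then 1 else 0)"

definition unitary_mat :: "nat \<Rightarrow> complex mat \<Rightarrow> bool" where
  "unitary_mat N U \<longleftrightarrow>
     U \<in> carrier_mat N N \<and> mat_adjoint U * U = 1\<^sub>m N \<and> U * mat_adjoint U = 1\<^sub>m N"

text \<open>
  An algorithm applies \<open>first_unitary\<close> to the basis state with number 0, and then, for each entry
  of \<open>later_unitaries\<close>, one oracle call followed by that unitary. Finally all registers are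
  measured in the computational basis and the output is read off the measured basis state by
  \<open>answer\<close>. None of the components depends on the input string.
\<close>

record query_algorithm =
  work_dim :: nat
  first_unitary :: "complex mat"
  later_unitaries :: "complex mat list"
  answer :: "nat \<Rightarrow> nat"

definition is_query_algorithm :: "nat \<Rightarrow> nat \<Rightarrow> query_algorithm \<Rightarrow> bool" where
  "is_query_algorithm n m A \<longleftrightarrow>
     work_dim A \<ge> 1 \<and>
     (\<forall>U \<in> insert (first_unitary A) (set (later_unitaries A)).
        unitary_mat (state_dim n m (work_dim A)) U)"

definition num_queries :: "query_algorithm \<Rightarrow> nat" where
  "num_queries A = length (later_unitaries A)"

definition final_state :: "nat \<Rightarrow> query_algorithm \<Rightarrow> nat list \<Rightarrow> complex vec" where
  "final_state m A s =
     fold (\<lambda>U \<psi>. U *\<^sub>v (oracle_mat m (work_dim A) s *\<^sub>v \<psi>)) (later_unitaries A)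
       (first_unitary A *\<^sub>v unit_vec (state_dim (length s) m (work_dim A)) 0)"

definition output_prob :: "nat \<Rightarrow> query_algorithm \<Rightarrow> nat list \<Rightarrow> nat \<Rightarrow> real" where
  "output_prob m A s x =
     (\<Sum>k \<in> {k. k < state_dim (length s) m (work_dim A) \<and> answer A k = x}.
        (cmod (final_state m A s $ k))\<^sup>2)"

definition solves_longest_lyndon :: "nat set \<Rightarrow> nat \<Rightarrow> nat \<Rightarrow> query_algorithm \<Rightarrow> bool" where
  "solves_longest_lyndon \<Sigma> m n A \<longleftrightarrow>
     (\<forall>s \<in> strings \<Sigma> n. output_prob m A s (longest_lyndon s) \<ge> 2 / 3)"

end

theory Submission
  imports Defs "HOL-Analysis.Convex"
begin

text \<open>
  Let \<open>a < b\<close> be two characters. The string \<open>a\<^sup>n\<close> has only Lyndon substrings of length 1, while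
  replacing any character but the first by \<open>b\<close> creates the Lyndon substring \<open>ab\<close>. An algorithm must
  therefore tell \<open>a\<^sup>n\<close> from each of \<open>n - 1\<close> strings at Hamming distance 1, and the hybrid argument
  of Bennett, Bernstein, Brassard and Vazirani applies: the final states on \<open>a\<^sup>n\<close> and on the string
  modified at \<open>j\<close> differ by at most twice the total amplitude norm that the \<open>T\<close> queries of the run
  on \<open>a\<^sup>n\<close> place on position \<open>j\<close>. Each of these differences is bounded below by a constant, whereas
  by Cauchy-Schwarz the sum of their squares over all \<open>j\<close> is at most \<open>4 T\<^sup>2\<close>.
\<close>

section \<open>Norms of vectors\<close>

abbreviation norm_on :: "nat set \<Rightarrow> complex vec \<Rightarrow> real" where
  "norm_on K v \<equiv> L2_set (\<lambda>k. cmod (v $ k)) K"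

lemma norm_on_power2: "(norm_on K v)\<^sup>2 = (\<Sum>k\<in>K. (cmod (v $ k))\<^sup>2)"
  unfolding L2_set_def by (intro real_sqrt_pow2 sum_nonneg) simp

lemma norm_on_add:
  assumes "K \<subseteq> {..<N}" "v \<in> carrier_vec N" "w \<in> carrier_vec N"
  shows "norm_on K (v + w) \<le> norm_on K v + norm_on K w"
proof -
  have "norm_on K (v + w) \<le> L2_set (\<lambda>k. cmod (v $ k) + cmod (w $ k)) K"
    using assms by (intro L2_set_mono) (auto simp: norm_triangle_ineq)
  then show ?thesis
    using L2_set_triangle_ineq[of "\<lambda>k. cmod (v $ k)" "\<lambda>k. cmod (w $ k)" K] by linarith
qed

lemma norm_on_diff:
  assumes "K \<subseteq> {..<N}" "v \<in> carrier_vec N" "w \<in> carrier_vec N"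
  shows "norm_on K (v - w) \<le> norm_on K v + norm_on K w"
proof -
  have "norm_on K (v - w) \<le> L2_set (\<lambda>k. cmod (v $ k) + cmod (w $ k)) K"
    using assms by (intro L2_set_mono) (auto simp: norm_triangle_ineq4)
  then show ?thesis
    using L2_set_triangle_ineq[of "\<lambda>k. cmod (v $ k)" "\<lambda>k. cmod (w $ k)" K] by linarith
qed

lemma norm_on_mono:
  assumes "finite L" "K \<subseteq> L"
  shows "norm_on K v \<le> norm_on L v"
  unfolding L2_set_def using assms by (intro real_sqrt_le_mono sum_mono2) auto

lemma diff_vec_split:
  fixes x y z :: "complex vec"
  assumes "x \<in> carrier_vec N" "y \<in> carrier_vec N" "z \<in> carrier_vec N"
  shows "x - z = (x - y) + (y - z)"
  using assms by (intro eq_vecI) auto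

section \<open>Unitary matrices preserve the norm\<close>

lemma unitary_mat_col_orthonormal:
  assumes U: "unitary_mat N U" and "i < N" "j < N"
  shows "(\<Sum>k<N. cnj (U $$ (k, i)) * U $$ (k, j)) = (if i = j then 1 else 0)"
proof -
  have c: "U \<in> carrier_mat N N" and "mat_adjoint U * U = 1\<^sub>m N"
    using U by (auto simp: unitary_mat_def)
  then have "(mat_adjoint U * U) $$ (i, j) = 1\<^sub>m N $$ (i, j)"
    by simp
  then show ?thesis
    using c assms(2,3)
    by (auto simp: mat_adjoint_def scalar_prod_def lessThan_atLeast0)
qed

text \<open>Expanding the squared norm of \<open>U v\<close> gives a triple sum; once the summation
  over rows is innermost, orthonormality of the columns leaves only the diagonal terms.\<close>

lemma norm_on_unitary_mult:
  assumes U: "unitary_mat N U" and v: "v \<in> carrier_vec N"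
  shows "norm_on {..<N} (U *\<^sub>v v) = norm_on {..<N} v"
proof -
  have c: "U \<in> carrier_mat N N"
    using U by (auto simp: unitary_mat_def)
  have "complex_of_real (\<Sum>k<N. (cmod ((U *\<^sub>v v) $ k))\<^sup>2)
      = (\<Sum>k<N. cnj ((U *\<^sub>v v) $ k) * (U *\<^sub>v v) $ k)"
    unfolding of_real_sum by (intro sum.cong refl) (simp only: complex_norm_square mult.commute)
  also have "\<dots> = (\<Sum>k<N. (\<Sum>i<N. cnj (U $$ (k, i)) * cnj (v $ i)) * (\<Sum>j<N. U $$ (k, j) * v $ j))"
    using c v by (intro sum.cong refl) (auto simp: scalar_prod_def lessThan_atLeast0)
  also have "\<dots> = (\<Sum>k<N. \<Sum>i<N. \<Sum>j<N. cnj (v $ i) * v $ j * (cnj (U $$ (k, i)) * U $$ (k, j)))"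
    unfolding sum_product by (intro sum.cong refl) (simp add: mult_ac)
  also have "\<dots> = (\<Sum>i<N. \<Sum>k<N. \<Sum>j<N. cnj (v $ i) * v $ j * (cnj (U $$ (k, i)) * U $$ (k, j)))"
    by (rule sum.swap)
  also have "\<dots> = (\<Sum>i<N. \<Sum>j<N. \<Sum>k<N. cnj (v $ i) * v $ j * (cnj (U $$ (k, i)) * U $$ (k, j)))"
    by (intro sum.cong refl sum.swap)
  also have "\<dots> = (\<Sum>i<N. \<Sum>j<N. cnj (v $ i) * v $ j * (if i = j then 1 else 0))"
    by (intro sum.cong refl) (simp add: sum_distrib_left[symmetric] unitary_mat_col_orthonormal[OF U])
  also have "\<dots> = (\<Sum>i<N. cnj (v $ i) * v $ i)"
    by (intro sum.cong refl) (simp add: if_distrib[of "(*) _"] cong: if_cong)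
  also have "\<dots> = complex_of_real (\<Sum>k<N. (cmod (v $ k))\<^sup>2)"
    unfolding of_real_sum by (intro sum.cong refl) (simp only: complex_norm_square mult.commute)
  finally show ?thesis
    unfolding L2_set_def of_real_eq_iff by simp
qed

section \<open>The oracle as a permutation of basis states\<close>

abbreviation ket_pos :: "nat \<Rightarrow> nat \<Rightarrow> nat \<Rightarrow> nat" where
  "ket_pos m d k \<equiv> k div d div 2 ^ m"

text \<open>The permutation of basis indices behind the oracle, an involution for characters of at
  most \<open>m\<close> bits. \<open>ket_pos\<close> counts positions from 0 but
  \<open>ket_index\<close> from 1, hence the \<open>Suc\<close>.\<close>

definition query_flip :: "nat \<Rightarrow> nat \<Rightarrow> nat list \<Rightarrow> nat \<Rightarrow> nat" where
  "query_flip m d s k =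
     ket_index m d (Suc (ket_pos m d k)) (xor (k div d mod 2 ^ m) (s ! ket_pos m d k)) (k mod d)"

lemma xor_less_power2:
  fixes a b :: nat
  assumes "a < 2 ^ m" "b < 2 ^ m"
  shows "xor a b < 2 ^ m"
  by (metis assms take_bit_nat_eq_self_iff take_bit_xor)

lemma ket_index_less:
  assumes "1 \<le> i" "i \<le> n" "b < 2 ^ m" "w < d"
  shows "ket_index m d i b w < state_dim n m d"
proof -
  have "(i - 1) * 2 ^ m + b + 1 \<le> (i - 1) * 2 ^ m + 2 ^ m"
    using assms by simp
  also have "\<dots> = i * 2 ^ m"
    using assms(1) by (cases i) auto
  also have "\<dots> \<le> n * 2 ^ m"
    using assms by simp
  finally have "((i - 1) * 2 ^ m + b + 1) * d \<le> n * 2 ^ m * d"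
    by (rule mult_le_mono1)
  then show ?thesis
    using assms by (simp add: ket_index_def state_dim_def)
qed

lemma ket_index_decode:
  assumes "b < 2 ^ m" "w < d"
  shows "ket_pos m d (ket_index m d i b w) = i - 1"
    and "ket_index m d i b w div d mod 2 ^ m = b"
    and "ket_index m d i b w mod d = w"
  using assms by (simp_all add: ket_index_def)

lemma ket_index_of_decode:
  "ket_index m d (Suc (ket_pos m d k)) (k div d mod 2 ^ m) (k mod d) = k"
  by (simp only: ket_index_def diff_Suc_1 div_mult_mod_eq)

lemma ket_pos_less:
  assumes "k < state_dim n m d"
  shows "ket_pos m d k < n"
  using assms by (simp add: state_dim_def less_mult_imp_div_less mult.assoc)

text \<open>The flip leaves the position alone, so a second flip xors the same character and cancels
  the first. The bound on the characters keeps the register within \<open>m\<close> bits, so that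
  decoding recovers it.\<close>

lemma query_flip_props:
  assumes k: "k < state_dim (length s) m d" and s: "set s \<subseteq> {..<2 ^ m}"
  shows "ket_pos m d (query_flip m d s k) = ket_pos m d k"
    and "query_flip m d s k < state_dim (length s) m d"
    and "query_flip m d s (query_flip m d s k) = k"
proof -
  have d: "0 < d"
    using k by (cases d) (auto simp: state_dim_def)
  have p: "ket_pos m d k < length s"
    by (rule ket_pos_less[OF k])
  have x: "xor (k div d mod 2 ^ m) (s ! ket_pos m d k) < 2 ^ m"
    using nth_mem[OF p] s by (intro xor_less_power2) auto
  have w: "k mod d < d"
    using d by simp
  show *: "ket_pos m d (query_flip m d s k) = ket_pos m d k"
    using ket_index_decode[OF x w] by (simp add: query_flip_def)
  show "query_flip m d s k < state_dim (length s) m d"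
    unfolding query_flip_def using p x w by (intro ket_index_less) auto
  show "query_flip m d s (query_flip m d s k) = k"
    unfolding query_flip_def[of m d s "query_flip m d s k"] *
    using ket_index_decode(2,3)[OF x w, of "Suc (ket_pos m d k)"] ket_index_of_decode[of m d k]
    by (simp add: query_flip_def xor.assoc)
qed

text \<open>The definition of the matrix maps columns to rows; since xoring twice with one character
  cancels, the same flip also leads from a row to its column.\<close>

lemma oracle_mat_entry:
  assumes s: "set s \<subseteq> {..<2 ^ m}"
    and r: "r < state_dim (length s) m d" and c: "c < state_dim (length s) m d"
  shows "oracle_mat m d s $$ (r, c) = (if c = query_flip m d s r then 1 else 0)"
proof -
  have "(\<exists>i \<in> {1..length s}. \<exists>b < 2 ^ m. \<exists>w < d.
           c = ket_index m d i b w \<and> r = ket_index m d i (xor b (char_at s i)) w)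
        \<longleftrightarrow> c = query_flip m d s r" (is "?L \<longleftrightarrow> ?R")
  proof
    assume ?L
    then obtain i b w where i: "i \<in> {1..length s}" and b: "b < 2 ^ m" and w: "w < d"
      and c: "c = ket_index m d i b w" and r: "r = ket_index m d i (xor b (s ! (i - 1))) w"
      unfolding char_at_def by blast
    have "s ! (i - 1) \<in> set s"
      using i by (intro nth_mem) auto
    then have "xor b (s ! (i - 1)) < 2 ^ m"
      using b s by (intro xor_less_power2) auto
    from ket_index_decode[OF this w, of i] i show ?R
      unfolding query_flip_def r c by (simp add: xor.assoc)
  next
    assume ?R
    have d: "0 < d"
      using r by (cases d) (auto simp: state_dim_def)
    have p: "ket_pos m d r < length s"
      by (rule ket_pos_less[OF r])
    have x: "xor (r div d mod 2 ^ m) (s ! ket_pos m d r) < 2 ^ m"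
      using nth_mem[OF p] s by (intro xor_less_power2) auto
    \<comment> \<open>The register before the call is the one encoded in \<open>r\<close>, xored
      once more with the character.\<close>
    show ?L
      by (rule bexI[of _ "Suc (ket_pos m d r)"],
          rule exI[of _ "xor (r div d mod 2 ^ m) (s ! ket_pos m d r)"],
          intro conjI exI[of _ "r mod d"])
        (use x d p \<open>?R\<close> ket_index_of_decode[of m d r] in
          \<open>auto simp: query_flip_def char_at_def xor.assoc\<close>)
  qed
  then show ?thesis
    using r c by (simp add: oracle_mat_def)
qed

lemma oracle_mat_carrier:
  "oracle_mat m d s \<in> carrier_mat (state_dim (length s) m d) (state_dim (length s) m d)"
  by (simp add: oracle_mat_def)

lemma oracle_mat_mult_vec:
  assumes s: "set s \<subseteq> {..<2 ^ m}" and v: "v \<in> carrier_vec (state_dim (length s) m d)"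
    and k: "k < state_dim (length s) m d"
  shows "(oracle_mat m d s *\<^sub>v v) $ k = v $ query_flip m d s k"
proof -
  have "(oracle_mat m d s *\<^sub>v v) $ k
      = (\<Sum>c<state_dim (length s) m d. oracle_mat m d s $$ (k, c) * v $ c)"
    using v k oracle_mat_carrier[of m d s] by (auto simp: scalar_prod_def lessThan_atLeast0)
  also have "\<dots> = (\<Sum>c<state_dim (length s) m d. if c = query_flip m d s k then v $ c else 0)"
    using k by (intro sum.cong refl) (simp add: oracle_mat_entry[OF s])
  also have "\<dots> = v $ query_flip m d s k"
    using query_flip_props(2)[OF k s] by simp
  finally show ?thesis .
qed

text \<open>The flip permutes every \<open>K\<close> cut out by a condition on the position, so the
  sum of squares is only reindexed. The predicate \<open>P\<close> covers both the whole space and a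
  single position.\<close>

lemma norm_on_oracle:
  assumes s: "set s \<subseteq> {..<2 ^ m}" and v: "v \<in> carrier_vec (state_dim (length s) m d)"
    and K: "K = {k. k < state_dim (length s) m d \<and> P (ket_pos m d k)}"
  shows "norm_on K (oracle_mat m d s *\<^sub>v v) = norm_on K v"
proof -
  have "bij_betw (query_flip m d s) K K"
    using query_flip_props[OF _ s, of _ d]
    by (intro bij_betw_byWitness[where f' = "query_flip m d s"]) (auto simp: K)
  then have "(\<Sum>k\<in>K. (cmod (v $ query_flip m d s k))\<^sup>2) = (\<Sum>k\<in>K. (cmod (v $ k))\<^sup>2)"
    by (rule sum.reindex_bij_betw)
  moreover have "(\<Sum>k\<in>K. (cmod ((oracle_mat m d s *\<^sub>v v) $ k))\<^sup>2)
      = (\<Sum>k\<in>K. (cmod (v $ query_flip m d s k))\<^sup>2)"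
    by (intro sum.cong refl) (simp add: K oracle_mat_mult_vec[OF s v])
  ultimately show ?thesis
    by (simp add: L2_set_def)
qed

lemma norm_on_oracle_full:
  assumes "set s \<subseteq> {..<2 ^ m}" "v \<in> carrier_vec (state_dim (length s) m d)"
  shows "norm_on {..<state_dim (length s) m d} (oracle_mat m d s *\<^sub>v v)
    = norm_on {..<state_dim (length s) m d} v"
  using assms by (rule norm_on_oracle[where P = "\<lambda>_. True"]) auto

text \<open>The basis states that query position \<open>j + 1\<close> of the string;
  \<open>j\<close> is a list index, counted from 0.\<close>

definition ket_block :: "nat \<Rightarrow> nat \<Rightarrow> nat \<Rightarrow> nat \<Rightarrow> nat set" where
  "ket_block n m d j = {k. k < state_dim n m d \<and> ket_pos m d k = j}"

text \<open>Off the block of \<open>j\<close> both oracles apply the same permutation, so the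
  difference vanishes there. On the block each oracle preserves the norm, and the triangle
  inequality yields the factor 2.\<close>

lemma oracle_mat_diff_le:
  assumes s: "set s \<subseteq> {..<2 ^ m}" and t: "set t \<subseteq> {..<2 ^ m}"
    and len: "length s = n" "length t = n"
    and eq: "\<And>i. i < n \<Longrightarrow> i \<noteq> j \<Longrightarrow> s ! i = t ! i"
    and v: "v \<in> carrier_vec (state_dim n m d)"
  shows "norm_on {..<state_dim n m d} (oracle_mat m d s *\<^sub>v v - oracle_mat m d t *\<^sub>v v)
    \<le> 2 * norm_on (ket_block n m d j) v"
proof -
  let ?N = "state_dim n m d" and ?K = "ket_block n m d j"
  let ?u = "oracle_mat m d s *\<^sub>v v" and ?w = "oracle_mat m d t *\<^sub>v v"
  have c: "?u \<in> carrier_vec ?N" "?w \<in> carrier_vec ?N"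
    using oracle_mat_carrier[of m d s] oracle_mat_carrier[of m d t] v len by auto
  have K: "?K \<subseteq> {..<?N}"
    by (auto simp: ket_block_def)
  have "(?u - ?w) $ k = 0" if "k \<in> {..<?N} - ?K" for k
  proof -
    have k: "k < ?N" "ket_pos m d k \<noteq> j"
      using that by (auto simp: ket_block_def)
    then have "query_flip m d s k = query_flip m d t k"
      using ket_pos_less[of k n m d] eq by (simp add: query_flip_def)
    then have "?u $ k = ?w $ k"
      using oracle_mat_mult_vec[OF s, of v d k] oracle_mat_mult_vec[OF t, of v d k] len v k
      by simp
    then show ?thesis
      using k c by (metis carrier_vecD index_minus_vec(1) right_minus_eq)
  qed
  then have "(\<Sum>k\<in>{..<?N}. (cmod ((?u - ?w) $ k))\<^sup>2) = (\<Sum>k\<in>?K. (cmod ((?u - ?w) $ k))\<^sup>2)"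
    using K by (intro sum.mono_neutral_right) auto
  then have "norm_on {..<?N} (?u - ?w) = norm_on ?K (?u - ?w)"
    by (simp add: L2_set_def)
  also have "\<dots> \<le> norm_on ?K ?u + norm_on ?K ?w"
    using K c by (rule norm_on_diff)
  also have "norm_on ?K ?u = norm_on ?K v"
    by (rule norm_on_oracle[OF s, where P = "\<lambda>p. p = j"]) (auto simp: len v ket_block_def)
  also have "norm_on ?K ?w = norm_on ?K v"
    by (rule norm_on_oracle[OF t, where P = "\<lambda>p. p = j"]) (auto simp: len v ket_block_def)
  finally show ?thesis
    by simp
qed

text \<open>Blocks of distinct positions are disjoint, so a state can only divide its squared norm
  among them.\<close>

lemma sum_norm_on_ket_block:
  assumes "J \<subseteq> {..<n}"
  shows "(\<Sum>j\<in>J. (norm_on (ket_block n m d j) v)\<^sup>2) \<le> (norm_on {..<state_dim n m d} v)\<^sup>2"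
proof -
  have fin: "finite J"
    using assms finite_subset by blast
  have "(\<Sum>j\<in>J. (norm_on (ket_block n m d j) v)\<^sup>2)
      = (\<Sum>k\<in>(\<Union>j\<in>J. ket_block n m d j). (cmod (v $ k))\<^sup>2)"
    unfolding norm_on_power2 using fin
    by (intro sum.UNION_disjoint[symmetric]) (auto simp: ket_block_def)
  also have "\<dots> \<le> (\<Sum>k<state_dim n m d. (cmod (v $ k))\<^sup>2)"
    by (intro sum_mono2) (auto simp: ket_block_def)
  finally show ?thesis
    by (simp add: norm_on_power2)
qed

section \<open>The hybrid argument\<close>

text \<open>Cutting the run off after \<open>t\<close> queries allows induction on the number of
  queries.\<close>

definition state_after :: "nat \<Rightarrow> query_algorithm \<Rightarrow> nat list \<Rightarrow> nat \<Rightarrow> complex vec" where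
  "state_after m A s t =
     fold (\<lambda>U \<psi>. U *\<^sub>v (oracle_mat m (work_dim A) s *\<^sub>v \<psi>)) (take t (later_unitaries A))
       (first_unitary A *\<^sub>v unit_vec (state_dim (length s) m (work_dim A)) 0)"

lemma final_state_eq: "final_state m A s = state_after m A s (num_queries A)"
  by (simp add: final_state_def state_after_def num_queries_def)

lemma state_after_Suc:
  assumes "t < num_queries A"
  shows "state_after m A s (Suc t)
    = later_unitaries A ! t *\<^sub>v (oracle_mat m (work_dim A) s *\<^sub>v state_after m A s t)"
  using assms by (simp add: state_after_def num_queries_def take_Suc_conv_app_nth)

lemma later_unitary:
  assumes "is_query_algorithm n m A" "t < num_queries A"
  shows "unitary_mat (state_dim n m (work_dim A)) (later_unitaries A ! t)"
  using assms by (auto simp: is_query_algorithm_def num_queries_def)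

lemma unitary_mult_carrier:
  assumes "unitary_mat N U" "v \<in> carrier_vec N"
  shows "U *\<^sub>v v \<in> carrier_vec N"
  using assms by (auto simp: unitary_mat_def)

lemma state_after_carrier:
  assumes A: "is_query_algorithm n m A" and s: "length s = n" and "t \<le> num_queries A"
  shows "state_after m A s t \<in> carrier_vec (state_dim n m (work_dim A))"
  using assms(3)
proof (induction t)
  case 0
  then show ?case
    using A s by (auto simp: state_after_def is_query_algorithm_def intro!: unitary_mult_carrier)
next
  case (Suc t)
  then have "oracle_mat m (work_dim A) s *\<^sub>v state_after m A s t
      \<in> carrier_vec (state_dim n m (work_dim A))"
    using oracle_mat_carrier[of m "work_dim A" s] s by auto
  then show ?case
    using Suc.prems unitary_mult_carrier[OF later_unitary[OF A, of t]] by (simp add: state_after_Suc)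
qed

lemma norm_state_after:
  assumes A: "is_query_algorithm n m A" and s: "length s = n" "set s \<subseteq> {..<2 ^ m}" and n: "0 < n"
    and "t \<le> num_queries A"
  shows "norm_on {..<state_dim n m (work_dim A)} (state_after m A s t) = 1"
  using assms(5)
proof (induction t)
  case 0
  let ?N = "state_dim n m (work_dim A)"
  have "0 < ?N"
    using A n by (auto simp: is_query_algorithm_def state_dim_def)
  have "norm_on {..<?N} (state_after m A s 0) = norm_on {..<?N} (unit_vec ?N 0)"
    using A s by (auto simp: state_after_def is_query_algorithm_def intro!: norm_on_unitary_mult)
  also have "(\<Sum>k<?N. (cmod (unit_vec ?N 0 $ k))\<^sup>2) = (\<Sum>k<?N. if k = 0 then 1 else 0)"
    by (intro sum.cong refl) (auto simp: unit_vec_def)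
  then have "norm_on {..<?N} (unit_vec ?N 0) = 1"
    using \<open>0 < ?N\<close> by (simp add: L2_set_def)
  finally show ?case .
next
  case (Suc t)
  have v: "state_after m A s t \<in> carrier_vec (state_dim (length s) m (work_dim A))"
    using state_after_carrier[OF A s(1), of t] Suc.prems s by simp
  have "oracle_mat m (work_dim A) s *\<^sub>v state_after m A s t
      \<in> carrier_vec (state_dim n m (work_dim A))"
    using v oracle_mat_carrier[of m "work_dim A" s] s by auto
  then show ?case
    using Suc norm_on_unitary_mult[OF later_unitary[OF A, of t]] norm_on_oracle_full[OF s(2) v] s
    by (simp add: state_after_Suc)
qed

text \<open>The error so far is preserved by the next query and unitary, and each query adds at most
  twice the weight on \<open>j\<close>. All weights are taken in the run on \<open>s'\<close>, so
  that one reference run can later serve every modified string.\<close>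

lemma state_after_diff_le:
  assumes A: "is_query_algorithm n m A"
    and s: "set s \<subseteq> {..<2 ^ m}" "length s = n" and s': "set s' \<subseteq> {..<2 ^ m}" "length s' = n"
    and eq: "\<And>i. i < n \<Longrightarrow> i \<noteq> j \<Longrightarrow> s ! i = s' ! i"
    and "t \<le> num_queries A"
  shows "norm_on {..<state_dim n m (work_dim A)} (state_after m A s t - state_after m A s' t)
    \<le> 2 * (\<Sum>u<t. norm_on (ket_block n m (work_dim A) j) (state_after m A s' u))"
  using assms(7)
proof (induction t)
  case 0
  \<comment> \<open>Before the first query the state depends on the input only through its
    length.\<close>
  have "norm_on {..<state_dim n m (work_dim A)} (state_after m A s 0 - state_after m A s' 0) = 0"
    using state_after_carrier[OF A s(2), of 0] s s'
    by (intro L2_set_0') (auto simp: state_after_def)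
  then show ?case
    by simp
next
  case (Suc t)
  let ?N = "state_dim n m (work_dim A)"
  let ?O = "oracle_mat m (work_dim A) s" and ?O' = "oracle_mat m (work_dim A) s'"
  let ?U = "later_unitaries A ! t"
  let ?v = "state_after m A s t" and ?v' = "state_after m A s' t"
  have U: "unitary_mat ?N ?U"
    using later_unitary[OF A] Suc.prems by simp
  then have cU: "?U \<in> carrier_mat ?N ?N"
    by (simp add: unitary_mat_def)
  have c: "?v \<in> carrier_vec ?N" "?v' \<in> carrier_vec ?N"
    using state_after_carrier[OF A] Suc.prems s s' by simp_all
  have cO: "?O \<in> carrier_mat ?N ?N" "?O' \<in> carrier_mat ?N ?N"
    using oracle_mat_carrier s s' by metis+
  have cOv: "?O *\<^sub>v ?v \<in> carrier_vec ?N" "?O' *\<^sub>v ?v' \<in> carrier_vec ?N" "?O *\<^sub>v ?v' \<in> carrier_vec ?N"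
    using c cO by auto
  have cd: "?v - ?v' \<in> carrier_vec ?N"
    using c by auto
  have "norm_on {..<?N} (state_after m A s (Suc t) - state_after m A s' (Suc t))
      = norm_on {..<?N} (?U *\<^sub>v (?O *\<^sub>v ?v - ?O' *\<^sub>v ?v'))"
    using Suc.prems by (simp add: state_after_Suc mult_minus_distrib_mat_vec[OF cU cOv(1,2)])
  also have "\<dots> = norm_on {..<?N} (?O *\<^sub>v ?v - ?O' *\<^sub>v ?v')"
    using cOv by (intro norm_on_unitary_mult[OF U]) auto
  \<comment> \<open>The hybrid term, the oracle of \<open>s\<close> applied to the state of
    \<open>s'\<close>, separates the earlier error under one common oracle from the fresh error of
    two oracles on one common state.\<close>
  also have "?O *\<^sub>v ?v - ?O' *\<^sub>v ?v' = ?O *\<^sub>v (?v - ?v') + (?O *\<^sub>v ?v' - ?O' *\<^sub>v ?v')"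
    unfolding mult_minus_distrib_mat_vec[OF cO(1) c] using cOv by (intro diff_vec_split) auto
  also have "norm_on {..<?N} \<dots>
      \<le> norm_on {..<?N} (?O *\<^sub>v (?v - ?v')) + norm_on {..<?N} (?O *\<^sub>v ?v' - ?O' *\<^sub>v ?v')"
    using cO cd cOv by (intro norm_on_add[of _ ?N]) auto
  also have "norm_on {..<?N} (?O *\<^sub>v (?v - ?v')) = norm_on {..<?N} (?v - ?v')"
    using norm_on_oracle_full[OF s(1), of "?v - ?v'" "work_dim A"] cd s by simp
  also have "norm_on {..<?N} (?O *\<^sub>v ?v' - ?O' *\<^sub>v ?v')
      \<le> 2 * norm_on (ket_block n m (work_dim A) j) ?v'"
    using oracle_mat_diff_le[OF s(1) s'(1) s(2) s'(2) eq c(2)] .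
  also have "norm_on {..<?N} (?v - ?v')
      \<le> 2 * (\<Sum>u<t. norm_on (ket_block n m (work_dim A) j) (state_after m A s' u))"
    using Suc by simp
  finally show ?case
    by simp
qed

text \<open>
  On the outcomes answered with \<open>x\<close>, the first state has norm at most \<open>sqrt (1 / 3) < 3 / 5\<close> and
  the second at least \<open>sqrt (2 / 3) > 4 / 5\<close>.
\<close>

lemma final_states_apart:
  assumes A: "is_query_algorithm n m A" and n: "0 < n"
    and s: "set s \<subseteq> {..<2 ^ m}" "length s = n" and s': "set s' \<subseteq> {..<2 ^ m}" "length s' = n"
    and y: "output_prob m A s y \<ge> 2 / 3" and x: "output_prob m A s' x \<ge> 2 / 3" and "x \<noteq> y"
  shows "norm_on {..<state_dim n m (work_dim A)} (final_state m A s - final_state m A s') \<ge> 1 / 5"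
proof -
  let ?N = "state_dim n m (work_dim A)"
  let ?K = "\<lambda>x. {k. k < ?N \<and> answer A k = x}"
  let ?v = "final_state m A s" and ?v' = "final_state m A s'"
  have c: "?v \<in> carrier_vec ?N" "?v' \<in> carrier_vec ?N"
    using state_after_carrier[OF A] s s' by (simp_all add: final_state_eq)
  \<comment> \<open>The outcomes for \<open>x\<close> and \<open>y\<close> are disjoint, so
    probability 2/3 for \<open>y\<close> leaves at most 1/3 for \<open>x\<close>.\<close>
  have "(norm_on (?K x) ?v)\<^sup>2 + (norm_on (?K y) ?v)\<^sup>2 = (\<Sum>k\<in>?K x \<union> ?K y. (cmod (?v $ k))\<^sup>2)"
    unfolding norm_on_power2 using \<open>x \<noteq> y\<close> by (intro sum.union_disjoint[symmetric]) auto
  also have "\<dots> \<le> (\<Sum>k<?N. (cmod (?v $ k))\<^sup>2)"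
    by (intro sum_mono2) auto
  also have "\<dots> = (norm_on {..<?N} ?v)\<^sup>2"
    by (simp add: norm_on_power2)
  also have "norm_on {..<?N} ?v = 1"
    using norm_state_after[OF A s(2,1) n] by (simp add: final_state_eq)
  finally have "(norm_on (?K x) ?v)\<^sup>2 \<le> 1 / 3"
    using y s by (simp add: norm_on_power2 output_prob_def)
  also have "\<dots> \<le> (3 / 5)\<^sup>2"
    by (simp add: power2_eq_square)
  finally have small: "norm_on (?K x) ?v \<le> 3 / 5"
    by (rule power2_le_imp_le) simp
  have "(4 / 5)\<^sup>2 \<le> (2 / 3 :: real)"
    by (simp add: power2_eq_square)
  also have "\<dots> \<le> (norm_on (?K x) ?v')\<^sup>2"
    using x s' by (simp add: norm_on_power2 output_prob_def)
  finally have large: "4 / 5 \<le> norm_on (?K x) ?v'"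
    by (rule power2_le_imp_le) simp
  have "norm_on (?K x) ?v' = norm_on (?K x) (?v - (?v - ?v'))"
    using c by (intro L2_set_cong) auto
  also have "\<dots> \<le> norm_on (?K x) ?v + norm_on (?K x) (?v - ?v')"
    using c by (intro norm_on_diff[of _ ?N]) auto
  also have "norm_on (?K x) (?v - ?v') \<le> norm_on {..<?N} (?v - ?v')"
    by (intro norm_on_mono) auto
  finally show ?thesis
    using small large by linarith
qed

text \<open>Every \<open>j\<close> in \<open>J\<close> demands weight from the single run on
  \<open>s\<close>, whose \<open>T\<close> queries supply total squared weight at most
  \<open>T\<close>; Cauchy-Schwarz contributes a second factor \<open>T\<close>.\<close>

lemma hybrid_query_bound:
  assumes A: "is_query_algorithm n m A" and n: "0 < n"
    and s: "set s \<subseteq> {..<2 ^ m}" "length s = n" and J: "J \<subseteq> {..<n}" and b: "b < 2 ^ m"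
    and x: "output_prob m A s x \<ge> 2 / 3"
    and y: "\<And>j. j \<in> J \<Longrightarrow> \<exists>y. y \<noteq> x \<and> output_prob m A (s[j := b]) y \<ge> 2 / 3"
  shows "real (card J) \<le> 100 * (real (num_queries A))\<^sup>2"
proof -
  let ?N = "state_dim n m (work_dim A)" and ?T = "num_queries A"
  let ?w = "\<lambda>j u. norm_on (ket_block n m (work_dim A) j) (state_after m A s u)"
  have lower: "1 / 100 \<le> real ?T * (\<Sum>u<?T. (?w j u)\<^sup>2)" if j: "j \<in> J" for j
  proof -
    from y[OF j] obtain y where y: "x \<noteq> y" "output_prob m A (s[j := b]) y \<ge> 2 / 3"
      by metis
    have t: "set (s[j := b]) \<subseteq> {..<2 ^ m}" "length (s[j := b]) = n"
      using s b set_update_subset_insert[of s j b] by auto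
    have "1 / 5 \<le> norm_on {..<?N} (final_state m A (s[j := b]) - final_state m A s)"
      using final_states_apart[OF A n t s y(2) x y(1)] .
    also have "\<dots> \<le> 2 * (\<Sum>u<?T. ?w j u)"
      unfolding final_state_eq by (rule state_after_diff_le[OF A t s]) auto
    \<comment> \<open>The distance \<open>1 / 5\<close> is halved by the factor 2 of the hybrid
      bound; squaring \<open>1 / 10\<close> is the source of the constant 100.\<close>
    finally have "(1 / 10)\<^sup>2 \<le> (\<Sum>u<?T. ?w j u)\<^sup>2"
      by (intro power_mono) auto
    also have "\<dots> \<le> real ?T * (\<Sum>u<?T. (?w j u)\<^sup>2)"
      using sum_squared_le_sum_of_squares[of "?w j" "{..<?T}"] by (simp add: mult.commute)
    finally show ?thesis
      by (simp add: power2_eq_square)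
  qed
  have "real (card J) / 100 = (\<Sum>j\<in>J. 1 / 100)"
    by simp
  also have "\<dots> \<le> (\<Sum>j\<in>J. real ?T * (\<Sum>u<?T. (?w j u)\<^sup>2))"
    using lower by (rule sum_mono)
  \<comment> \<open>After the swap the inner sum spreads one unit vector over the positions, so it
    is at most 1 for each query.\<close>
  also have "\<dots> = real ?T * (\<Sum>u<?T. \<Sum>j\<in>J. (?w j u)\<^sup>2)"
    unfolding sum_distrib_left[symmetric] by (subst sum.swap) simp
  also have "\<dots> \<le> real ?T * (\<Sum>u<?T. 1)"
  proof (intro mult_left_mono sum_mono)
    fix u assume "u \<in> {..<?T}"
    then show "(\<Sum>j\<in>J. (?w j u)\<^sup>2) \<le> 1"
      using sum_norm_on_ket_block[OF J, where m = m and d = "work_dim A" and v = "state_after m A s u"]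
        norm_state_after[OF A s(2,1) n, of u] by simp
  qed simp
  finally show ?thesis
    by (simp add: power2_eq_square)
qed

section \<open>Hard inputs for the longest Lyndon substring\<close>

lemma lyndon_singleton: "lyndon [a]"
  by (auto simp: lyndon_def strict_suffix_def suffix_Cons)

lemma lyndon_pair: "a < b \<Longrightarrow> lyndon [a, b]"
  by (auto simp: lyndon_def strict_suffix_def suffix_Cons lex_less_def)

text \<open>The one-letter suffix is a proper prefix of the word and therefore precedes it.\<close>

lemma not_lyndon_replicate:
  assumes "2 \<le> l"
  shows "\<not> lyndon (replicate l a)"
proof
  assume "lyndon (replicate l a)"
  moreover obtain k where l: "l = Suc (Suc k)"
    using assms by (metis Suc_le_D numeral_2_eq_2 Suc_le_mono)
  have "strict_suffix [a] (replicate l a)"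
    unfolding strict_suffix_def suffix_def l
    by (auto intro!: exI[of _ "replicate (Suc k) a"] simp: replicate_append_same)
  ultimately have "(replicate l a, [a]) \<in> lexord {(a, b). a < b}"
    by (auto simp: lyndon_def lex_less_def)
  then show False
    by (simp add: l)
qed

lemma finite_lyndon_lengths:
  "finite {l. \<exists>i. 1 \<le> i \<and> i + l \<le> length s + 1 \<and> lyndon (substring s i (i + l))}"
  by (rule finite_subset[of _ "{..length s}"]) auto

lemma longest_lyndon_replicate:
  assumes "0 < n"
  shows "longest_lyndon (replicate n a) = 1"
proof -
  have "{l. \<exists>i. 1 \<le> i \<and> i + l \<le> length (replicate n a) + 1
          \<and> lyndon (substring (replicate n a) i (i + l))} = {1}" (is "?L = _")
  proof (intro equalityI subsetI)
    fix l assume "l \<in> ?L"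
    then obtain i where i: "1 \<le> i" "i + l \<le> n + 1"
      and "lyndon (substring (replicate n a) i (i + l))"
      by auto
    moreover have "substring (replicate n a) i (i + l) = replicate l a"
      using i by (simp add: substring_def min_def)
    ultimately have "lyndon (replicate l a)"
      by simp
    then have "l \<noteq> 0" "\<not> 2 \<le> l"
      using not_lyndon_replicate by (auto simp: lyndon_def)
    then show "l \<in> {1}"
      by auto
  next
    fix l :: nat assume "l \<in> {1}"
    with assms show "l \<in> ?L"
      by (auto intro!: exI[of _ 1] simp: substring_def lyndon_singleton min_def)
  qed
  then show ?thesis
    by (simp add: longest_lyndon_def)
qed

text \<open>List index \<open>j\<close> is position \<open>j + 1\<close>, so the substring starting
  at position \<open>j\<close> consists of the \<open>a\<close> just before the change and the new
  \<open>b\<close>; \<open>1 \<le> j\<close> ensures that this \<open>a\<close> exists. Longer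
  Lyndon words such as \<open>aab\<close> can occur, hence only a lower bound.\<close>

lemma longest_lyndon_replicate_update:
  assumes "a < b" "1 \<le> j" "j < n"
  shows "2 \<le> longest_lyndon ((replicate n a)[j := b])"
proof -
  let ?s = "(replicate n a)[j := b]"
  have "substring ?s j (j + 2) = [a, b]"
    using assms by (intro nth_equalityI) (auto simp: substring_def nth_list_update less_2_cases_iff)
  then have "lyndon (substring ?s j (j + 2))"
    using assms by (simp add: lyndon_pair)
  then show ?thesis
    unfolding longest_lyndon_def using assms
    by (intro Max_ge finite_lyndon_lengths) (auto intro!: exI[of _ j])
qed

section \<open>From the hard inputs to the lower bound\<close>

lemma card_ge_2_obtain_less:
  fixes S :: "nat set"
  assumes "2 \<le> card S"
  obtains a b where "a \<in> S" "b \<in> S" "a < b"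
proof -
  \<comment> \<open>An infinite set has \<open>card\<close> 0, so the assumption forces finiteness
    as well as two distinct elements.\<close>
  obtain a b where "a \<in> S" "b \<in> S" "a \<noteq> b"
    using assms card_le_Suc0_iff_eq[of S] card.infinite[of S]
    by (metis One_nat_def Suc_1 not_less_eq_eq zero_neq_numeral le_zero_eq)
  then show thesis
    using that by (cases a b rule: linorder_cases) auto
qed

text \<open>The reference input is constant, and changing it at any of the \<open>n - 1\<close> list
  indices from 1 on moves the answer away from 1.\<close>

lemma longest_lyndon_query_bound:
  assumes n: "2 \<le> n" and card: "card \<Sigma> \<ge> 2" and \<Sigma>: "\<Sigma> \<subseteq> {..<2 ^ m}"
    and A: "is_query_algorithm n m A" and solves: "solves_longest_lyndon \<Sigma> m n A"
  shows "real n - 1 \<le> 100 * (real (num_queries A))\<^sup>2"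
proof -
  obtain a b where ab: "a \<in> \<Sigma>" "b \<in> \<Sigma>" "a < b"
    using card by (rule card_ge_2_obtain_less)
  let ?s = "replicate n a"
  have "?s \<in> strings \<Sigma> n"
    using ab by (auto simp: strings_def)
  then have "output_prob m A ?s 1 \<ge> 2 / 3"
    using solves n longest_lyndon_replicate[of n a] unfolding solves_longest_lyndon_def
    by fastforce
  moreover have "\<exists>y. y \<noteq> 1 \<and> output_prob m A (?s[j := b]) y \<ge> 2 / 3" if j: "j \<in> {1..<n}" for j
  proof (intro exI conjI)
    show "longest_lyndon (?s[j := b]) \<noteq> 1"
      using longest_lyndon_replicate_update[OF ab(3), of j n] j by auto
    have "?s[j := b] \<in> strings \<Sigma> n"
      using ab set_update_subset_insert[of ?s j b] by (auto simp: strings_def)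
    then show "output_prob m A (?s[j := b]) (longest_lyndon (?s[j := b])) \<ge> 2 / 3"
      using solves by (simp add: solves_longest_lyndon_def)
  qed
  ultimately have "real (card {1..<n}) \<le> 100 * (real (num_queries A))\<^sup>2"
    using n ab \<Sigma> by (intro hybrid_query_bound[OF A, where s = ?s and b = b and x = 1]) auto
  then show ?thesis
    using n by (simp add: of_nat_diff)
qed

theorem mainTheorem7:
  shows "\<exists>c > (0::real). \<exists>n\<^sub>0. \<forall>n \<ge> n\<^sub>0. \<forall>(\<Sigma>::nat set) m A.
           card \<Sigma> \<ge> 2 \<and> \<Sigma> \<subseteq> {..<2 ^ m} \<and>
           is_query_algorithm n m A \<and> solves_longest_lyndon \<Sigma> m n A
           \<longrightarrow> real (num_queries A) \<ge> c * sqrt (real n)"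
proof (intro exI[of _ "1 / 20 :: real"] conjI exI[of _ "2 :: nat"] allI impI)
  fix n m :: nat and \<Sigma> :: "nat set" and A
  assume n: "2 \<le> n"
    and "card \<Sigma> \<ge> 2 \<and> \<Sigma> \<subseteq> {..<2 ^ m} \<and> is_query_algorithm n m A \<and> solves_longest_lyndon \<Sigma> m n A"
  then have "real n - 1 \<le> 100 * (real (num_queries A))\<^sup>2"
    using longest_lyndon_query_bound by blast
  \<comment> \<open>For \<open>n \<ge> 2\<close>, \<open>n \<le> 2 * (n - 1)\<close>, which is at
    most 200 times the squared query count. Rounding 200 up to the square 400 gives the constant
    \<open>1 / 20\<close>.\<close>
  then have "real n \<le> (20 * real (num_queries A))\<^sup>2"
    using n by (simp add: power_mult_distrib)
  then have "sqrt (real n) \<le> 20 * real (num_queries A)"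
    by (intro real_le_lsqrt) auto
  then show "1 / 20 * sqrt (real n) \<le> real (num_queries A)"
    by simp
qed simp

end
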